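(* Let $\Gamma$ be a circle with center $O$ and radius $R>0$ in the Euclidean plane, let $\mu$ be the uniform probability measure on $\Gamma$, and let $X$ be a point inside $\Gamma$ (that is, $|OX|<R$). Put $r=\frac{|OX|}{R}\in[0,1)$, and let $P(r)$ be the probability that the triangle $ABC$ contains $X$, where $A,B,C$ are independent random points of $\Gamma$, each distributed according to $\mu$. For $C\in\Gamma$ let $\operatorname{dif}(XC)$ denote the difference of the $\mu$-measures of the two arcs into which the line $XC$ separates $\Gamma$. Then $$P(r)=\frac14-\frac34\int_{\Gamma}\operatorname{dif}(XC)^2\,d\mu(C).$$
   Context: The measure $\mu$ is normalized arc length, so $\mu(\Gamma)=1$. For $C\in\Gamma$, since $X$ lies strictly inside $\Gamma$, the line $XC$ is well defined and meets $\Gamma$ in exactly two points, which separate $\Gamma$ into two arcs. Explicitly, $\operatorname{dif}(XC)=\int_{\Gamma}\mathcal{R}(A,\overrightarrow{XC})\,d\mu(A)$, where $\overrightarrow{XC}$ is the line $XC$ oriented from $X$ to $C$, and $\mathcal{R}(A,\overrightarrow{XC})=+1$ if $A$ lies to the right of $\overrightarrow{XC}$ or on it, and $-1$ if $A$ lies to the left of $\overrightarrow{XC}$. Only the square of $\operatorname{dif}(XC)$ is used, so its sign is irrelevant. By rotational symmetry and scaling, the probability depends only on $r$, which justifies the notation $P(r)$. Whether the boundary of the triangle is counted as part of it does not affect the probability. *)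

theory Defs
  imports "HOL-Probability.Probability"
begin

text \<open>The Euclidean plane is \<^typ>\<open>complex\<close>. Normalized arc length on the circle with
  centre \<open>c\<close> and radius \<open>R\<close> is the image of the uniform distribution of the angle; as a Borel
  measure on the plane it is concentrated on \<open>sphere c R\<close> (lemma \<open>AE_circle_measure\<close>), so that
  integrals with respect to it are integrals over the circle.\<close>

definition circle_measure :: "complex \<Rightarrow> real \<Rightarrow> complex measure" where
  "circle_measure c R =
     distr (uniform_measure lborel {0..<2 * pi}) borel (\<lambda>t. c + of_real R * cis t)"

lemma measurable_circle_param [measurable]:
  "(\<lambda>t. c + of_real R * cis t) \<in> borel_measurable borel"
  by (intro borel_measurable_continuous_onI continuous_intros)

lemma sets_circle_measure [measurable_cong, simp]: "sets (circle_measure c R) = sets borel"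
  and space_circle_measure [simp]: "space (circle_measure c R) = UNIV"
  by (simp_all add: circle_measure_def)

lemma prob_space_circle_measure: "prob_space (circle_measure c R)"
proof -
  have "prob_space (uniform_measure lborel {0..<2 * pi})"
    by (rule prob_space_uniform_measure) auto
  then show ?thesis
    unfolding circle_measure_def by (rule prob_space.prob_space_distr) simp
qed

lemma AE_circle_measure:
  assumes "R > 0"
  shows "AE A in circle_measure c R. A \<in> sphere c R"
  unfolding circle_measure_def
  using assms by (subst AE_distr_iff) (auto simp: dist_norm norm_mult)

text \<open>The line through \<open>X\<close> and \<open>C\<close> is oriented from \<open>X\<close> to \<open>C\<close>. A point \<open>A\<close> lies to its left iff the
  cross product of \<open>C - X\<close> and \<open>A - X\<close> is positive.\<close>

definition side :: "complex \<Rightarrow> complex \<Rightarrow> complex \<Rightarrow> real" where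
  "side X C A =
     (if Re (C - X) * Im (A - X) - Im (C - X) * Re (A - X) > 0 then - 1 else 1)"

definition dif :: "complex \<Rightarrow> real \<Rightarrow> complex \<Rightarrow> complex \<Rightarrow> real" where
  "dif c R X C = (\<integral>A. side X C A \<partial>circle_measure c R)"

lemma measurable_side [measurable]: "side X C \<in> borel_measurable borel"
proof -
  have [measurable]: "Re \<in> borel_measurable borel" "Im \<in> borel_measurable borel"
    by (intro borel_measurable_continuous_onI continuous_intros)+
  show ?thesis unfolding side_def[abs_def] by measurable
qed

lemma dif_eq_measure_diff:
  assumes "R > 0"
  shows "dif c R X C =
    measure (circle_measure c R) {A \<in> sphere c R. side X C A = 1} -
    measure (circle_measure c R) {A \<in> sphere c R. side X C A = - 1}"
proof -
  let ?M = "circle_measure c R"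
  interpret prob_space ?M by (rule prob_space_circle_measure)
  let ?S = "\<lambda>e. {A \<in> sphere c R. side X C A = e}"
  have meas: "?S e \<in> sets ?M" for e
  proof -
    have "side X C -` {e} \<inter> space borel \<in> sets borel" by measurable
    moreover have "sphere c R \<in> sets borel" by simp
    moreover have "?S e = sphere c R \<inter> (side X C -` {e} \<inter> space borel)" by auto
    ultimately show ?thesis by (metis sets.Int sets_circle_measure)
  qed
  have "dif c R X C = (\<integral>A. indicator (?S 1) A - indicator (?S (- 1)) A \<partial>?M)"
    unfolding dif_def
  proof (rule integral_cong_AE)
    show "AE A in ?M. side X C A = indicator (?S 1) A - indicator (?S (- 1)) A"
      using AE_circle_measure[OF assms, of c]
      by eventually_elim (auto simp: side_def indicator_def)
  qed (use meas in \<open>auto\<close>)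
  also have "\<dots> = measure ?M (?S 1) - measure ?M (?S (- 1))"
    using meas by (subst Bochner_Integration.integral_diff) (auto simp: emeasure_eq_measure)
  finally show ?thesis .
qed

definition triangle_prob :: "complex \<Rightarrow> real \<Rightarrow> complex \<Rightarrow> real" where
  "triangle_prob c R X =
     measure (circle_measure c R \<Otimes>\<^sub>M circle_measure c R \<Otimes>\<^sub>M circle_measure c R)
       {(A, B, C). X \<in> convex hull {A, B, C}}"

text \<open>As a function of the ratio alone: the value for the unit circle about the origin and the point
  at distance \<open>r\<close> on the positive real axis.\<close>

definition P :: "real \<Rightarrow> real" where
  "P r = triangle_prob 0 1 (of_real r)"

end

theory Submission
  imports Defs
begin

text \<open>Let \<open>e A B\<close> be the sign of the cross product of \<open>A - X\<close> and \<open>B - X\<close>, almost surely \<open>\<plusminus>1\<close>. Almost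
  surely, \<open>X\<close> lies in the triangle iff the three signs \<open>e A B\<close>, \<open>e B C\<close>, \<open>e C A\<close> agree, and the
  indicator of this event is \<open>(1 + e A B e B C + e B C e C A + e C A e A B) / 4\<close>. Given \<open>B\<close>, the
  factors of \<open>e A B e B C\<close> are independent with means \<open>dif(XB)\<close> and \<open>- dif(XB)\<close>, so each of the three
  products has expectation minus the integral of \<open>dif\<^sup>2\<close>.\<close>

section \<open>Signed areas and the containment criterion\<close>

text \<open>Twice the signed area of the triangle \<open>X\<close>, \<open>A\<close>,
  \<open>B\<close>. The argument order is chosen so that \<open>cross X C A\<close> is the
  expression tested in \<open>side X C A\<close>.\<close>

definition cross :: "complex \<Rightarrow> complex \<Rightarrow> complex \<Rightarrow> real" where
  "cross X A B = Re (A - X) * Im (B - X) - Im (A - X) * Re (B - X)"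

lemma cross_swap: "cross X B A = - cross X A B"
  by (simp add: cross_def)

lemma cross_eq_Im: "cross X A B = Im (cnj (A - X) * (B - X))"
  by (simp add: cross_def algebra_simps)

text \<open>Translations cancel in the differences, and a complex factor \<open>w\<close> multiplies
  \<open>cnj (A - X) * (B - X)\<close> by \<open>cnj w * w\<close>, which is real.\<close>

lemma cross_similarity:
  "cross (c + of_real R * cis \<theta> * X) (c + of_real R * cis \<theta> * A) (c + of_real R * cis \<theta> * B)
    = R\<^sup>2 * cross X A B"
proof -
  let ?w = "of_real R * cis \<theta>"
  have "cnj ?w * ?w = of_real (R\<^sup>2)"
    by (simp add: cis_cnj cis_mult power2_eq_square)
  moreover have "cnj (?w * (A - X)) * (?w * (B - X)) = (cnj ?w * ?w) * (cnj (A - X) * (B - X))"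
    by simp
  moreover have "c + ?w * Y - (c + ?w * X) = ?w * (Y - X)" for Y
    by (simp add: algebra_simps)
  ultimately show ?thesis
    by (simp only: cross_eq_Im scaleR_complex.sel flip: scaleR_conv_of_real)
qed

lemma measurable_cross [measurable (raw)]:
  assumes "f \<in> borel_measurable M" "g \<in> borel_measurable M"
  shows "(\<lambda>x. cross X (f x) (g x)) \<in> borel_measurable M"
proof -
  have [measurable]: "Re \<in> borel_measurable borel" "Im \<in> borel_measurable borel"
    by (intro borel_measurable_continuous_onI continuous_intros)+
  note [measurable] = assms
  show ?thesis unfolding cross_def by measurable
qed

lemma side_eq_sgn_cross:
  "cross X C A \<noteq> 0 \<Longrightarrow> side X C A = - sgn (cross X C A)"
  by (simp add: side_def cross_def sgn_if)

text \<open>The signed areas \<open>cross X B C\<close>, \<open>cross X C A\<close>,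
  \<open>cross X A B\<close> are the barycentric coordinates of \<open>X\<close> with respect to
  \<open>A\<close>, \<open>B\<close>, \<open>C\<close>, up to division by their sum.\<close>

lemma in_convex_hull_3_iff_sgn_cross:
  assumes "cross X A B \<noteq> 0" "cross X B C \<noteq> 0" "cross X C A \<noteq> 0"
  shows "X \<in> convex hull {A, B, C} \<longleftrightarrow>
    sgn (cross X A B) = sgn (cross X B C) \<and> sgn (cross X B C) = sgn (cross X C A)"
proof
  assume "X \<in> convex hull {A, B, C}"
  then obtain u v w where nn: "0 \<le> u" "0 \<le> v" "0 \<le> w" and sum: "u + v + w = 1"
    and X: "X = u *\<^sub>R A + v *\<^sub>R B + w *\<^sub>R C"
    unfolding convex_hull_3 by blast
  have u: "u = 1 - v - w" using sum by simp
  have X_Re: "Re X = u * Re A + v * Re B + w * Re C"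
    and X_Im: "Im X = u * Im A + v * Im B + w * Im C"
    using X by simp_all
  \<comment> \<open>Both come from the relation u (A - X) + v (B - X) + w (C - X) = 0, by taking
    cross products with A - X and with B - X.\<close>
  have 1: "v * cross X A B = w * cross X C A"
    and 2: "u * cross X A B = w * cross X B C"
    unfolding cross_def minus_complex.sel X_Re X_Im u by algebra+
  have pos: "w > 0"
    using 1 2 assms nn sum by (cases "w = 0") auto
  have "v > 0" "u > 0"
    using 1 2 assms nn pos by (cases "v = 0"; cases "u = 0"; force)+
  with pos have "sgn (cross X A B) = sgn (w * cross X C A)"
      "sgn (cross X A B) = sgn (w * cross X B C)"
    by (simp_all flip: 1 2 add: sgn_mult)
  then show "sgn (cross X A B) = sgn (cross X B C) \<and> sgn (cross X B C) = sgn (cross X C A)"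
    using pos by (simp add: sgn_mult)
next
  assume eq: "sgn (cross X A B) = sgn (cross X B C) \<and> sgn (cross X B C) = sgn (cross X C A)"
  \<comment> \<open>Twice the signed area of \<open>A\<close>, \<open>B\<close>, \<open>C\<close>.
    Summands of equal nonzero sign cannot cancel, and dividing by \<open>s\<close> makes them
    nonnegative.\<close>
  define s where "s = cross X A B + cross X B C + cross X C A"
  have s: "s \<noteq> 0" and nn: "cross X A B / s \<ge> 0" "cross X B C / s \<ge> 0" "cross X C A / s \<ge> 0"
    using eq assms unfolding s_def
    by (auto simp: sgn_if zero_le_divide_iff split: if_splits)
  have "s * Re X = cross X B C * Re A + cross X C A * Re B + cross X A B * Re C"
       "s * Im X = cross X B C * Im A + cross X C A * Im B + cross X A B * Im C"
    unfolding s_def cross_def minus_complex.sel by algebra+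
  then have "X = (cross X B C / s) *\<^sub>R A + (cross X C A / s) *\<^sub>R B + (cross X A B / s) *\<^sub>R C"
    using s by (simp add: complex_eq_iff field_simps)
  moreover have "cross X B C / s + cross X C A / s + cross X A B / s = 1"
    using s by (simp add: s_def flip: add_divide_distrib)
  ultimately show "X \<in> convex hull {A, B, C}"
    using nn unfolding convex_hull_3 by blast
qed

section \<open>Measurability of the event and null sets of the circle\<close>

text \<open>The set is the projection of a closed set of weights and vertices along the compact cube
  of weights. Its closedness makes the event Borel.\<close>

lemma closed_triangles_containing:
  fixes X :: "'a::euclidean_space"
  shows "closed {(A, B, C). X \<in> convex hull {A, B, C}}"
proof -
  define S where "S = {0..1::real} \<times> {0..1::real} \<times> {0..1::real}"
  define T where "T = {((u, v, w), (A, B, C)) | u v w A B C.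
    u + v + w = 1 \<and> X = u *\<^sub>R A + v *\<^sub>R B + w *\<^sub>R (C :: 'a)}"
  have "T = {p. fst (fst p) + fst (snd (fst p)) + snd (snd (fst p)) = 1} \<inter>
     {p. X = fst (fst p) *\<^sub>R fst (snd p) + fst (snd (fst p)) *\<^sub>R fst (snd (snd p)) +
       snd (snd (fst p)) *\<^sub>R snd (snd (snd p))}"
    unfolding T_def by auto
  also have "closed \<dots>"
    by (intro closed_Int closed_Collect_eq continuous_intros)
  finally have "closed T" .
  moreover have "compact S"
    unfolding S_def by (intro compact_Times compact_Icc)
  ultimately have "closed {y. \<exists>x. x \<in> S \<and> (x, y) \<in> T}"
    by (intro closed_compact_projection)
  also have "{y. \<exists>x. x \<in> S \<and> (x, y) \<in> T} = {(A, B, C). X \<in> convex hull {A, B, C}}"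
    unfolding S_def T_def convex_hull_3 by fastforce
  finally show ?thesis .
qed

text \<open>On the line through \<open>X\<close> and \<open>A\<close>, parametrized by X + u (A -
  X), the equation of the circle is a quadratic in u with nonzero leading coefficient.\<close>

lemma finite_line_inter_sphere:
  assumes "A \<noteq> X"
  shows "finite {B \<in> sphere c R. cross X A B = 0}"
proof -
  define a b where "a = Re (A - X)" and "b = Im (A - X)"
  define p q where "p = Re (X - c)" and "q = Im (X - c)"
  \<comment> \<open>The squared distance of X + u (A - X) from \<open>c\<close>, minus the square of
    \<open>R\<close>, as a polynomial in u.\<close>
  define f where "f = [:p\<^sup>2 + q\<^sup>2 - R\<^sup>2, 2 * (a * p + b * q), a\<^sup>2 + b\<^sup>2:]"
  have nz: "a\<^sup>2 + b\<^sup>2 \<noteq> 0"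
    using assms by (auto simp: a_def b_def complex_eq_iff sum_power2_eq_zero_iff)
  then have "f \<noteq> 0" by (simp add: f_def)
  have "\<exists>u. poly f u = 0 \<and> B = X + of_real u * (A - X)"
    if B: "dist c B = R" "cross X A B = 0" for B
  proof (intro exI conjI)
    define x y where "x = Re (B - X)" and "y = Im (B - X)"
    define u where "u = (a * x + b * y) / (a\<^sup>2 + b\<^sup>2)"
    have cr: "a * y = b * x"
      using B(2) by (simp add: cross_def a_def b_def x_def y_def)
    have u: "u * a = x" "u * b = y"
      using nz cr unfolding u_def by (simp_all add: field_simps power2_eq_square)
    show "B = X + of_real u * (A - X)"
      using u by (simp add: complex_eq_iff a_def b_def x_def y_def)
    have "(cmod (B - c))\<^sup>2 = R\<^sup>2"
      using B(1) by (simp add: dist_norm norm_minus_commute)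
    then have "(p + x)\<^sup>2 + (q + y)\<^sup>2 = R\<^sup>2"
      by (simp add: cmod_power2 p_def q_def x_def y_def)
    then show "poly f u = 0"
      unfolding f_def u(1)[symmetric] u(2)[symmetric]
      by (simp add: algebra_simps power2_eq_square)
  qed
  then have "{B \<in> sphere c R. cross X A B = 0} \<subseteq> (\<lambda>u. X + of_real u * (A - X)) ` {u. poly f u = 0}"
    by auto
  then show ?thesis
    using poly_roots_finite[OF \<open>f \<noteq> 0\<close>] finite_surj by blast
qed

text \<open>Over one period the angle is determined by the point, so a finite set has only finitely
  many angles, which Lebesgue measure ignores.\<close>

lemma finite_null_sets_circle_measure:
  assumes "R > 0" "finite F"
  shows "F \<in> null_sets (circle_measure c R)"
proof -
  let ?f = "\<lambda>t. c + of_real R * cis t"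
  have F: "F \<in> sets borel"
    using assms by (simp add: borel_closed finite_imp_closed)
  have "inj_on ?f {0..<2 * pi}"
    using assms by (intro inj_on_inverseI[where g = "\<lambda>z. Arg2pi ((z - c) / of_real R)"])
      (auto simp: cis_conv_exp intro!: Arg2pi_unique[of 1])
  then have "finite (?f -` F \<inter> {0..<2 * pi})"
    using assms by (simp add: finite_vimage_IntI)
  then have "emeasure lborel ({0..<2 * pi} \<inter> ?f -` F) = 0"
    by (simp add: Int_commute emeasure_lborel_countable countable_finite)
  then show ?thesis
    using F measurable_sets[OF measurable_circle_param F]
    by (simp add: null_sets_def circle_measure_def emeasure_distr)
qed

lemma AE_cross_nonzero:
  assumes "R > 0" "A \<noteq> X"
  shows "AE B in circle_measure c R. cross X A B \<noteq> 0"
proof -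
  have "AE B in circle_measure c R. B \<notin> {B \<in> sphere c R. cross X A B = 0}"
    using assms by (intro AE_not_in finite_null_sets_circle_measure finite_line_inter_sphere)
  with AE_circle_measure[OF assms(1), of c] show ?thesis
    by eventually_elim auto
qed

section \<open>Invariance under similarities\<close>

lemma emeasure_lborel_translate:
  assumes "S \<in> sets borel"
  shows "emeasure lborel {t. a + t \<in> S} = emeasure lborel (S :: real set)"
proof -
  have "emeasure lborel S = emeasure (distr lborel borel ((+) a)) S"
    by (simp add: lborel_distr_plus)
  also have "\<dots> = emeasure lborel {t. a + t \<in> S}"
    using assms by (subst emeasure_distr) (auto simp: vimage_def)
  finally show ?thesis by simp
qed

text \<open>The shift moves the window to [a, p + a). The part beyond \<open>p\<close> is carried
  back by one period to [0, a), which completes [a, p) to the original window.\<close>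

lemma emeasure_periodic_translate:
  fixes T :: "real set"
  assumes T [measurable]: "T \<in> sets borel" and per: "\<And>t. p + t \<in> T \<longleftrightarrow> t \<in> T"
    and a: "0 \<le> a" "a \<le> p"
  shows "emeasure lborel ({0..<p} \<inter> {t. a + t \<in> T}) = emeasure lborel ({0..<p} \<inter> T)"
proof -
  have "{0..<p} \<inter> {t. a + t \<in> T} = {t. a + t \<in> {a..<p + a} \<inter> T}"
    by auto
  then have "emeasure lborel ({0..<p} \<inter> {t. a + t \<in> T}) = emeasure lborel ({a..<p + a} \<inter> T)"
    by (simp only: emeasure_lborel_translate T sets.Int atLeastLessThan_borel)
  also have "{a..<p + a} \<inter> T = {a..<p} \<inter> T \<union> {p..<p + a} \<inter> T"
    using a by auto
  also have "emeasure lborel \<dots> = emeasure lborel ({a..<p} \<inter> T) + emeasure lborel ({p..<p + a} \<inter> T)"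
    by (intro plus_emeasure[symmetric]) auto
  also have "emeasure lborel ({p..<p + a} \<inter> T) = emeasure lborel {t. p + t \<in> {p..<p + a} \<inter> T}"
    by (simp only: emeasure_lborel_translate T sets.Int atLeastLessThan_borel)
  also have "{t. p + t \<in> {p..<p + a} \<inter> T} = {0..<a} \<inter> T"
    using per by auto
  also have "emeasure lborel ({a..<p} \<inter> T) + emeasure lborel ({0..<a} \<inter> T)
      = emeasure lborel ({a..<p} \<inter> T \<union> {0..<a} \<inter> T)"
    by (intro plus_emeasure) auto
  also have "{a..<p} \<inter> T \<union> {0..<a} \<inter> T = {0..<p} \<inter> T"
    using a by auto
  finally show ?thesis .
qed

text \<open>Multiplication by \<open>cis \<theta>\<close> adds \<theta> to the angle, so rotation
  invariance is the invariance of Lebesgue measure on one period; \<open>c\<close> and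
  \<open>R\<close> only enter the parametrization.\<close>

lemma distr_circle_measure_similarity:
  assumes "0 \<le> \<theta>" "\<theta> \<le> 2 * pi"
  shows "distr (circle_measure 0 1) borel (\<lambda>z. c + of_real R * cis \<theta> * z) = circle_measure c R"
    (is "?L = ?R")
proof (rule measure_eqI)
  fix S assume "S \<in> sets ?L"
  then have S: "S \<in> sets borel" by simp
  define T where "T = {t. c + of_real R * cis t \<in> S}"
  have T: "T \<in> sets borel"
    using measurable_sets[OF measurable_circle_param S] by (simp add: T_def vimage_def)
  have per: "2 * pi + t \<in> T \<longleftrightarrow> t \<in> T" for t
    by (simp add: T_def flip: cis_mult)
  have T': "{t. \<theta> + t \<in> T} \<in> sets borel"
    using measurable_sets[of "(+) \<theta>" borel borel, OF _ T] by (simp add: vimage_def)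
  have [measurable]: "(\<lambda>z. c + of_real R * cis \<theta> * z) \<in> borel_measurable borel"
    by (intro borel_measurable_continuous_onI continuous_intros)
  have comp: "(\<lambda>z. c + of_real R * cis \<theta> * z) \<circ> (\<lambda>t. 0 + of_real 1 * cis t)
      = (\<lambda>t. c + of_real R * cis (\<theta> + t))"
    by (simp add: fun_eq_iff cis_mult mult.assoc)
  have "?L = distr (uniform_measure lborel {0..<2 * pi}) borel (\<lambda>t. c + of_real R * cis (\<theta> + t))"
    unfolding circle_measure_def by (subst distr_distr) (simp_all only: comp, measurable)
  moreover have "(\<lambda>t. c + of_real R * cis (\<theta> + t)) \<in> borel_measurable borel"
    by (intro borel_measurable_continuous_onI continuous_intros)
  ultimately have "emeasure ?L S = emeasure (uniform_measure lborel {0..<2 * pi}) {t. \<theta> + t \<in> T}"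
    using S by (simp add: emeasure_distr T_def vimage_def)
  also have "\<dots> = emeasure (uniform_measure lborel {0..<2 * pi}) T"
    using T T' emeasure_periodic_translate[OF T per assms] by simp
  also have "\<dots> = emeasure ?R S"
    using S by (simp add: circle_measure_def emeasure_distr T_def vimage_def)
  finally show "emeasure ?L S = emeasure ?R S" .
qed simp

lemma integral_circle_measure_similarity:
  fixes f :: "complex \<Rightarrow> real"
  assumes "0 \<le> \<theta>" "\<theta> \<le> 2 * pi" and f: "f \<in> borel_measurable borel"
  shows "(\<integral>z. f z \<partial>circle_measure c R) = (\<integral>z. f (c + of_real R * cis \<theta> * z) \<partial>circle_measure 0 1)"
proof -
  have "(\<lambda>z. c + of_real R * cis \<theta> * z) \<in> borel_measurable borel"
    by (intro borel_measurable_continuous_onI continuous_intros)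
  then show ?thesis
    unfolding distr_circle_measure_similarity[OF assms(1,2), of c R, symmetric]
    using f by (subst integral_distr) auto
qed

text \<open>The similarity multiplies \<open>cross\<close> by a positive number, so it preserves
  left and right, and it transports one circle measure to the other.\<close>

lemma dif_similarity:
  assumes "R > 0" "0 \<le> \<theta>" "\<theta> \<le> 2 * pi"
  shows "dif c R (c + of_real R * cis \<theta> * X) (c + of_real R * cis \<theta> * C) = dif 0 1 X C"
proof -
  have "side (c + of_real R * cis \<theta> * X) (c + of_real R * cis \<theta> * C) (c + of_real R * cis \<theta> * A)
     = side X C A" for A
    using cross_similarity[of c R \<theta> X C A] assms
    by (simp only: side_def zero_less_mult_iff flip: cross_def) auto
  then show ?thesis
    unfolding dif_def using assms
    by (subst integral_circle_measure_similarity[of \<theta>]) auto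
qed

lemma measurable_dif [measurable]: "dif c R X \<in> borel_measurable borel"
proof -
  interpret prob_space "circle_measure c R" by (rule prob_space_circle_measure)
  have [measurable]: "Re \<in> borel_measurable borel" "Im \<in> borel_measurable borel"
    by (intro borel_measurable_continuous_onI continuous_intros)+
  show ?thesis unfolding dif_def[abs_def] side_def[abs_def] by measurable
qed

section \<open>Expectation of the cyclic sum of sign products\<close>

text \<open>The probabilistic core, free of geometry. Each product has one shared variable, which is
  the first argument of one factor and the second of the other; by antisymmetry, integrating out the
  other two variables leaves minus a square.\<close>

lemma (in prob_space) expectation_cyclic_antisymmetric:
  fixes e :: "'a \<Rightarrow> 'a \<Rightarrow> real"
  assumes e [measurable]: "case_prod e \<in> borel_measurable (M \<Otimes>\<^sub>M M)"
    and anti: "\<And>x y. e y x = - e x y"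
    and bound: "\<And>x y. \<bar>e x y\<bar> \<le> 1"
  shows "(\<integral>(x, y, z). e x y * e y z + e y z * e z x + e z x * e x y \<partial>(M \<Otimes>\<^sub>M M \<Otimes>\<^sub>M M))
    = - 3 * (\<integral>x. (\<integral>y. e x y \<partial>M)\<^sup>2 \<partial>M)"
proof -
  interpret P2: pair_prob_space M M ..
  interpret P3: pair_prob_space M "M \<Otimes>\<^sub>M M" ..
  define D where "D x = (\<integral>y. e x y \<partial>M)" for x
  have D [measurable]: "D \<in> borel_measurable M"
    unfolding D_def by measurable
  have D_bound: "\<bar>D x\<bar> \<le> 1" for x
  \<comment> \<open>For \<open>x\<close> outside the space of \<open>M\<close> the function
    \<open>e x\<close> might not be measurable; the integral of a non-integrable function is 0,
    which satisfies the bound too.\<close>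
  proof (cases "integrable M (e x)")
    case True
    then have "\<bar>D x\<bar> \<le> (\<integral>y. \<bar>e x y\<bar> \<partial>M)"
      unfolding D_def by simp
    also have "\<dots> \<le> (\<integral>y. 1 \<partial>M)"
      using True bound by (intro integral_mono) auto
    finally show ?thesis by (simp add: prob_space)
  qed (simp add: D_def not_integrable_integral_eq)
  have D': "(\<integral>x. e x y \<partial>M) = - D y" for y
    unfolding D_def by (subst anti) simp
  have prod_bound: "\<bar>a * b\<bar> \<le> 1" if "\<bar>a\<bar> \<le> 1" "\<bar>b\<bar> \<le> 1" for a b :: real
    using that by (simp add: abs_mult mult_le_one)
  \<comment> \<open>Two orders of the inner integrals are provided: \<open>z\<close> first suits the
    products sharing \<open>x\<close> or \<open>y\<close>, while the product sharing
    \<open>z\<close> is integrated over \<open>y\<close> first.\<close>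
  have triple: "integrable (M \<Otimes>\<^sub>M M \<Otimes>\<^sub>M M) f" "(\<integral>p. f p \<partial>(M \<Otimes>\<^sub>M M \<Otimes>\<^sub>M M)) =
      (\<integral>x. \<integral>y. \<integral>z. f (x, y, z) \<partial>M \<partial>M \<partial>M)"
      "(\<integral>p. f p \<partial>(M \<Otimes>\<^sub>M M \<Otimes>\<^sub>M M)) = (\<integral>x. \<integral>z. \<integral>y. f (x, y, z) \<partial>M \<partial>M \<partial>M)"
    if f [measurable]: "f \<in> borel_measurable (M \<Otimes>\<^sub>M M \<Otimes>\<^sub>M M)" and "\<And>p. \<bar>f p\<bar> \<le> 1" for f :: "_ \<Rightarrow> real"
  proof -
    show int: "integrable (M \<Otimes>\<^sub>M M \<Otimes>\<^sub>M M) f"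
      using that by (intro P3.integrable_const_bound[of _ 1]) auto
    have int2: "integrable (M \<Otimes>\<^sub>M M) (\<lambda>p. f (x, p))" if "x \<in> space M" for x
      using that \<open>\<And>p. \<bar>f p\<bar> \<le> 1\<close> by (intro P2.integrable_const_bound[of _ 1]) auto
    show "(\<integral>p. f p \<partial>(M \<Otimes>\<^sub>M M \<Otimes>\<^sub>M M)) = (\<integral>x. \<integral>y. \<integral>z. f (x, y, z) \<partial>M \<partial>M \<partial>M)"
      unfolding P3.integral_fst'[OF int, symmetric]
      using int2 by (intro Bochner_Integration.integral_cong refl P2.integral_fst'[symmetric])
    also have "\<dots> = (\<integral>x. \<integral>z. \<integral>y. f (x, y, z) \<partial>M \<partial>M \<partial>M)"
      using int2 by (intro Bochner_Integration.integral_cong refl P2.Fubini_integral[symmetric]) (simp add: split_def)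
    finally show "(\<integral>p. f p \<partial>(M \<Otimes>\<^sub>M M \<Otimes>\<^sub>M M)) = (\<integral>x. \<integral>z. \<integral>y. f (x, y, z) \<partial>M \<partial>M \<partial>M)" .
  qed
  define I where "I = (\<integral>x. (D x)\<^sup>2 \<partial>M)"
  have pair: "(\<integral>x. \<integral>y. e x y * D y \<partial>M \<partial>M) = - I"
  proof -
    have "integrable (M \<Otimes>\<^sub>M M) (\<lambda>(x, y). e x y * D y)"
      using bound D_bound by (intro P2.integrable_const_bound[of _ 1]) (auto intro!: prod_bound)
    then have "(\<integral>x. \<integral>y. e x y * D y \<partial>M \<partial>M) = (\<integral>y. \<integral>x. e x y * D y \<partial>M \<partial>M)"
      by (rule P2.Fubini_integral[symmetric])
    then show ?thesis
      by (simp add: D' I_def power2_eq_square)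
  qed
  let ?N = "M \<Otimes>\<^sub>M M \<Otimes>\<^sub>M M"
  define f1 f2 f3 where "f1 = (\<lambda>(x, y, z). e x y * e y z)"
    and "f2 = (\<lambda>(x, y, z). e y z * e z x)" and "f3 = (\<lambda>(x, y, z). e z x * e x y)"
  have m [measurable]: "f1 \<in> borel_measurable ?N" "f2 \<in> borel_measurable ?N" "f3 \<in> borel_measurable ?N"
    unfolding f1_def f2_def f3_def by measurable
  have b: "\<bar>f1 p\<bar> \<le> 1" "\<bar>f2 p\<bar> \<le> 1" "\<bar>f3 p\<bar> \<le> 1" for p
    unfolding f1_def f2_def f3_def by (auto split: prod.split intro!: prod_bound bound)
  have "integral\<^sup>L ?N f1 = - I"
    unfolding triple(2)[OF m(1) b(1)] using pair by (simp add: f1_def flip: D_def)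
  moreover have "integral\<^sup>L ?N f2 = - I"
  proof -
    have "(\<integral>y. f2 (x, y, z) \<partial>M) = e x z * D z" for x z
      by (simp add: f2_def D' anti[of x z])
    with pair show ?thesis
      unfolding triple(3)[OF m(2) b(2)] by simp
  qed
  moreover have "integral\<^sup>L ?N f3 = - I"
    unfolding triple(2)[OF m(3) b(3)]
    by (simp add: f3_def D' I_def power2_eq_square flip: D_def)
  moreover have "(\<integral>(x, y, z). e x y * e y z + e y z * e z x + e z x * e x y \<partial>?N)
      = (\<integral>p. f1 p + f2 p + f3 p \<partial>?N)"
    by (simp add: f1_def f2_def f3_def split_def)
  ultimately show ?thesis
    using triple(1)[OF m(1) b(1)] triple(1)[OF m(2) b(2)] triple(1)[OF m(3) b(3)]
    by (simp add: I_def D_def)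
qed

section \<open>The formula for an arbitrary circle\<close>

lemma triangle_prob_eq_integral_dif:
  assumes R: "R > 0" and X: "dist c X < R"
  shows "triangle_prob c R X = 1/4 - 3/4 * (\<integral>C. (dif c R X C)\<^sup>2 \<partial>circle_measure c R)"
proof -
  let ?M = "circle_measure c R"
  let ?N = "?M \<Otimes>\<^sub>M ?M \<Otimes>\<^sub>M ?M"
  interpret M: prob_space ?M by (rule prob_space_circle_measure)
  interpret P2: pair_prob_space ?M ?M ..
  interpret P3: pair_prob_space ?M "?M \<Otimes>\<^sub>M ?M" ..
  let ?e = "\<lambda>A B. sgn (cross X A B)"
  let ?H = "{(A, B, C). X \<in> convex hull {A, B, C}}"
  let ?s = "\<lambda>(A, B, C). ?e A B * ?e B C + ?e B C * ?e C A + ?e C A * ?e A B"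
  have "sets ?N = sets (borel :: (complex \<times> complex \<times> complex) measure)"
    by (simp add: borel_prod[symmetric] cong: sets_pair_measure_cong)
  then have H [measurable]: "?H \<in> sets ?N"
    using closed_triangles_containing[of X] by auto
  have e [measurable]: "case_prod ?e \<in> borel_measurable (?M \<Otimes>\<^sub>M ?M)"
    by measurable
  have s [measurable]: "?s \<in> borel_measurable ?N"
    by measurable
  \<comment> \<open>This uses that \<open>X\<close> lies strictly inside: for \<open>A\<close> =
    \<open>X\<close> the cross product with every \<open>B\<close> would vanish.\<close>
  have ne: "AE A in ?M. A \<noteq> X"
    using AE_circle_measure[OF R, of c] by eventually_elim (use X in auto)
  have cr: "AE A in ?M. A \<noteq> X \<and> (AE B in ?M. cross X A B \<noteq> 0)"
    using ne by eventually_elim (simp add: AE_cross_nonzero[OF R])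
  \<comment> \<open>By Fubini it suffices to choose the points in turn: \<open>B\<close> and
    \<open>C\<close> almost surely avoid the line through \<open>X\<close> and \<open>A\<close>, and
    \<open>C\<close> that through \<open>X\<close> and \<open>B\<close>.\<close>
  have ae: "AE (A, B, C) in ?N. cross X A B \<noteq> 0 \<and> cross X B C \<noteq> 0 \<and> cross X C A \<noteq> 0"
  proof (rule P3.AE_pair_measure)
    show "AE A in ?M. AE p in ?M \<Otimes>\<^sub>M ?M. case (A, p) of (A, B, C) \<Rightarrow>
        cross X A B \<noteq> 0 \<and> cross X B C \<noteq> 0 \<and> cross X C A \<noteq> 0"
      using cr
    proof eventually_elim
      case (elim A)
      have "AE (B, C) in ?M \<Otimes>\<^sub>M ?M. cross X A B \<noteq> 0 \<and> cross X B C \<noteq> 0 \<and> cross X C A \<noteq> 0"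
      proof (rule P2.AE_pair_measure)
        from elim have *: "AE B in ?M. cross X A B \<noteq> 0" by simp
        then have "AE C in ?M. cross X C A \<noteq> 0"
          by eventually_elim (simp add: cross_swap[of X _ A])
        with * cr show "AE B in ?M. AE C in ?M. case (B, C) of (B, C) \<Rightarrow>
            cross X A B \<noteq> 0 \<and> cross X B C \<noteq> 0 \<and> cross X C A \<noteq> 0"
          by (auto elim!: eventually_elim2)
      qed measurable
      then show ?case by simp
    qed
  qed measurable
  have "triangle_prob c R X = (\<integral>p. indicator ?H p \<partial>?N)"
    using H by (simp add: triangle_prob_def space_pair_measure)
  \<comment> \<open>Of three signs either all agree and \<open>?s\<close> is 3, or exactly one
    differs and \<open>?s\<close> is -1; the integrand is then 1 or 0.\<close>
  also have "\<dots> = (\<integral>p. 1/4 + 1/4 * ?s p \<partial>?N)"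
  proof (rule integral_cong_AE)
    show "AE p in ?N. indicator ?H p = 1/4 + 1/4 * ?s p"
      using ae
    proof eventually_elim
      case (elim p)
      obtain A B C where p: "p = (A, B, C)" by (cases p)
      show ?case
        using elim in_convex_hull_3_iff_sgn_cross[of X A B C]
        by (auto simp: p indicator_def sgn_if)
    qed
  qed measurable
  also have "\<dots> = 1/4 + 1/4 * (\<integral>p. ?s p \<partial>?N)"
  proof -
    have "\<bar>?s p\<bar> \<le> 3" for p
      by (auto simp: sgn_if split: prod.split)
    then have "integrable ?N ?s"
      by (intro P3.integrable_const_bound[of _ 3]) auto
    then show ?thesis
      by (subst Bochner_Integration.integral_add) (auto simp: P3.prob_space)
  qed
  also have "(\<integral>p. ?s p \<partial>?N) = - 3 * (\<integral>A. (\<integral>B. ?e A B \<partial>?M)\<^sup>2 \<partial>?M)"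
  proof (rule M.expectation_cyclic_antisymmetric[OF e])
    show "?e B A = - ?e A B" for A B
      by (simp add: cross_swap[of X B A] sgn_minus)
    show "\<bar>?e A B\<bar> \<le> 1" for A B
      by (simp add: sgn_if)
  qed
  also have "(\<integral>A. (\<integral>B. ?e A B \<partial>?M)\<^sup>2 \<partial>?M) = (\<integral>C. (dif c R X C)\<^sup>2 \<partial>?M)"
  proof (rule integral_cong_AE)
    show "AE A in ?M. (\<integral>B. ?e A B \<partial>?M)\<^sup>2 = (dif c R X A)\<^sup>2"
      using cr
    proof eventually_elim
      case (elim A)
      then have "AE B in ?M. cross X A B \<noteq> 0" by simp
      \<comment> \<open>\<open>side\<close> is -1 on the left, where \<open>cross\<close> is
        positive; the resulting minus sign disappears on squaring.\<close>
      then have "AE B in ?M. side X A B = - ?e A B"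
        by eventually_elim (rule side_eq_sgn_cross)
      then have "dif c R X A = (\<integral>B. - ?e A B \<partial>?M)"
        unfolding dif_def by (intro integral_cong_AE) auto
      then show ?case by simp
    qed
  qed measurable
  finally show ?thesis by simp
qed

section \<open>Dependence on the ratio alone\<close>

text \<open>The formula is applied to the given circle and to the unit circle. A similarity matches
  the two integrals of the squared \<open>dif\<close>, and the equality of the two probabilities
  follows from this.\<close>

theorem mainTheorem1:
  fixes c X :: complex and R r :: real
  assumes "R > 0"
    and "dist c X < R"
    and "r = dist c X / R"
  shows "triangle_prob c R X = P r \<and>
    P r = 1/4 - 3/4 * (\<integral>C. (dif c R X C)\<^sup>2 \<partial>circle_measure c R)"
proof -
  define \<theta> where "\<theta> = Arg2pi (X - c)"
  have \<theta>: "0 \<le> \<theta>" "\<theta> \<le> 2 * pi"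
    using Arg2pi[of "X - c"] by (simp_all add: \<theta>_def)
  \<comment> \<open>Polar form of X - c. For \<open>X\<close> = \<open>c\<close> it still holds,
    since \<open>r\<close> is then 0 whatever the angle.\<close>
  have "X - c = of_real (R * r) * cis \<theta>"
    using Arg2pi_eq[of "X - c"] assms
    by (simp add: \<theta>_def cis_conv_exp dist_norm norm_minus_commute[of c])
  then have X: "X = c + of_real R * cis \<theta> * of_real r"
    by (simp add: algebra_simps)
  have "(\<integral>C. (dif c R X C)\<^sup>2 \<partial>circle_measure c R) = (\<integral>C. (dif 0 1 (of_real r) C)\<^sup>2 \<partial>circle_measure 0 1)"
    unfolding X using assms(1) \<theta>
    by (subst integral_circle_measure_similarity[of \<theta>]) (simp_all add: dif_similarity)
  moreover have "P r = 1/4 - 3/4 * (\<integral>C. (dif 0 1 (of_real r) C)\<^sup>2 \<partial>circle_measure 0 1)"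
    unfolding P_def using assms by (intro triangle_prob_eq_integral_dif) (auto simp flip: of_real_divide)
  ultimately show ?thesis
    using triangle_prob_eq_integral_dif[OF assms(1,2)] by simp
qed

end
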